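(* Let $D\subset\mathbf{R}^2$ be a convex compact set with $0\in\operatorname{int} D$, and let $r_0$ be its radial function. Then the variational problem $VP(r_0)$ has a unique solution $r\in\mathcal{F}$. This solution is the radial function of a convex compact set in $\mathbf{R}^2$, and it is the only function of the form $$\frac1{r(t)}=\frac{a}{r_0(t)}+b\cos t+c\sin t$$ with $a>0$ and $b,c\in\mathbf{R}$ that satisfies the constraints of $VP(r_0)$.
   Context: $\mathcal{F}$ is the set of all positive continuous functions $r:[0,2\pi]\to\mathbf{R}^+$ with $r(0)=r(2\pi)$. Let $u(t)=(\cos t,\sin t)$. A function $r\in\mathcal{F}$ is the radial function of the starshaped set $\{\rho u(t): t\in[0,2\pi],\,0\le\rho\le r(t)\}$. A convex compact set $K$ with $0\in\operatorname{int}K$ is starshaped in this sense: its radial function at $t$ is the distance from the origin to the unique point where the half-line from the origin in direction $u(t)$ meets the boundary of $K$. The variational problem $VP(r_0)$ is: among $r\in\mathcal{F}$, minimize $$\int_0^{2\pi}\frac{r^3(t)}{r_0(t)}\,dt$$ subject to the constraints $$\int_0^{2\pi}r^3(t)\cos t\,dt=0,\qquad \int_0^{2\pi}r^3(t)\sin t\,dt=0,\qquad \frac12\int_0^{2\pi}r^2(t)\,dt=1.$$ A solution of $VP(r_0)$ is a function in $\mathcal{F}$ satisfying the constraints and attaining the minimum. *)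

theory Defs
  imports "HOL-Analysis.Analysis"
begin

definition unit_dir :: "real \<Rightarrow> real ^ 2" where
  "unit_dir t = vector [cos t, sin t]"

text \<open>Functions with domain \<open>[0, 2\<pi>]\<close> are represented as extensional functions (with value
  \<^term>\<open>undefined\<close> outside the interval), so equality of two of them is equality on
  \<open>[0, 2\<pi>]\<close>.\<close>

definition radial_functions :: "(real \<Rightarrow> real) set" where
  "radial_functions =
     {r \<in> {0..2*pi} \<rightarrow>\<^sub>E {0<..}. continuous_on {0..2*pi} r \<and> r 0 = r (2*pi)}"

definition starshaped_set :: "(real \<Rightarrow> real) \<Rightarrow> (real ^ 2) set" where
  "starshaped_set r = {\<rho> *\<^sub>R unit_dir t | \<rho> t. t \<in> {0..2*pi} \<and> 0 \<le> \<rho> \<and> \<rho> \<le> r t}"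

text \<open>Meaningful when \<open>K\<close> is compact and convex with the origin in its interior: each
  half-line from the origin then meets the boundary in exactly one point.\<close>

definition radial_function :: "(real ^ 2) set \<Rightarrow> real \<Rightarrow> real" where
  "radial_function K =
     (\<lambda>t\<in>{0..2*pi}. dist 0 (THE p. p \<in> frontier K \<and> (\<exists>s\<ge>0. p = s *\<^sub>R unit_dir t)))"

definition VP_objective :: "(real \<Rightarrow> real) \<Rightarrow> (real \<Rightarrow> real) \<Rightarrow> real" where
  "VP_objective r\<^sub>0 r = integral {0..2*pi} (\<lambda>t. r t ^ 3 / r\<^sub>0 t)"

definition VP_constraints :: "(real \<Rightarrow> real) \<Rightarrow> bool" where
  "VP_constraints r \<longleftrightarrow>
     integral {0..2*pi} (\<lambda>t. r t ^ 3 * cos t) = 0 \<and>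
     integral {0..2*pi} (\<lambda>t. r t ^ 3 * sin t) = 0 \<and>
     1/2 * integral {0..2*pi} (\<lambda>t. r t ^ 2) = 1"

definition VP_solution :: "(real \<Rightarrow> real) \<Rightarrow> (real \<Rightarrow> real) \<Rightarrow> bool" where
  "VP_solution r\<^sub>0 r \<longleftrightarrow>
     r \<in> radial_functions \<and> VP_constraints r \<and>
     (\<forall>s\<in>radial_functions. VP_constraints s \<longrightarrow> VP_objective r\<^sub>0 r \<le> VP_objective r\<^sub>0 s)"

definition VP_form :: "(real \<Rightarrow> real) \<Rightarrow> (real \<Rightarrow> real) \<Rightarrow> bool" where
  "VP_form r\<^sub>0 r \<longleftrightarrow>
     (\<exists>a b c. a > 0 \<and> (\<forall>t\<in>{0..2*pi}. 1 / r t = a / r\<^sub>0 t + b * cos t + c * sin t))"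

end

theory Submission
  imports Defs
begin

text \<open>Let \<open>H\<close> be the gauge (Minkowski functional) of \<open>D\<close>, so that \<open>1/r\<^sub>0 = H \<circ> u\<close>. A function
  \<open>r\<close> of the required form is \<open>1/(Q \<circ> u)\<close> with \<open>Q(x) = a H(x) + v \<bullet> x\<close>; being again a gauge, \<open>Q\<close>
  has a convex unit ball, with radial function \<open>r\<close>. To meet the moment constraints, minimise
  \<open>\<integral> 1/(H(u(t)) + v \<bullet> u(t))\<^sup>2 dt\<close> over all \<open>v\<close> keeping the denominator positive (the Santalo point
  of the polar body): since \<open>H \<circ> u\<close> is Lipschitz the integral blows up at the boundary, so a
  minimiser exists and its critical point equation is the vanishing of the moments. Rescaling gives the area
  constraint. Any feasible function of this form is the strict minimiser of the variational
  problem, by integrating a pointwise inequality.\<close>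

section \<open>Gauges and their comparison with the Euclidean norm\<close>

text \<open>Homogeneity is asked only for nonnegative scalars because \<open>D\<close> need not be
  symmetric: \<open>H (- x)\<close> and \<open>H x\<close> may differ. On a Euclidean space these
  are exactly the Minkowski functionals of compact convex sets with the origin in the
  interior.\<close>

definition pos_gauge :: "('a::real_vector \<Rightarrow> real) \<Rightarrow> bool" where
  "pos_gauge H \<longleftrightarrow>
     (\<forall>x y. H (x + y) \<le> H x + H y) \<and> (\<forall>s x. 0 \<le> s \<longrightarrow> H (s *\<^sub>R x) = s * H x) \<and>
     (\<forall>x. x \<noteq> 0 \<longrightarrow> 0 < H x)"

lemma
  assumes "pos_gauge H"
  shows pos_gauge_add: "H (x + y) \<le> H x + H y"
    and pos_gauge_scale: "0 \<le> s \<Longrightarrow> H (s *\<^sub>R x) = s * H x"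
    and pos_gauge_pos: "x \<noteq> 0 \<Longrightarrow> 0 < H x"
  using assms unfolding pos_gauge_def by blast+

lemma pos_gauge_zero: "pos_gauge H \<Longrightarrow> H 0 = 0"
  using pos_gauge_scale[of H 0 0] by simp

lemma pos_gauge_convex_on:
  assumes "pos_gauge H"
  shows "convex_on UNIV H"
proof (rule convex_onI)
  fix t :: real and x y :: 'a
  assume "0 < t" "t < 1"
  then show "H ((1 - t) *\<^sub>R x + t *\<^sub>R y) \<le> (1 - t) * H x + t * H y"
    using pos_gauge_add[OF assms, of "(1 - t) *\<^sub>R x" "t *\<^sub>R y"]
    by (simp add: pos_gauge_scale[OF assms])
qed auto

lemma pos_gauge_continuous:
  fixes H :: "'a::euclidean_space \<Rightarrow> real"
  assumes "pos_gauge H"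
  shows "continuous_on S H"
proof -
  have "continuous_on UNIV H"
    using convex_on_continuous[OF open_UNIV pos_gauge_convex_on[OF assms]] .
  then show ?thesis
    using continuous_on_subset by blast
qed

lemma pos_gauge_sphere:
  assumes "pos_gauge H"
  shows "H x = norm x * H (x /\<^sub>R norm x)"
  using pos_gauge_scale[OF assms, of "norm x" "x /\<^sub>R norm x"]
  by (cases "x = 0") (auto simp: pos_gauge_zero[OF assms])

lemma pos_gauge_upper:
  fixes H :: "'a::euclidean_space \<Rightarrow> real"
  assumes "pos_gauge H"
  obtains M where "0 \<le> M" "\<And>x. H x \<le> M * norm x"
proof -
  have "bounded (H ` sphere 0 1)"
    by (intro compact_imp_bounded compact_continuous_image pos_gauge_continuous assms) simp
  then obtain M where M: "0 < M" "\<And>x. norm x = 1 \<Longrightarrow> \<bar>H x\<bar> \<le> M"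
    unfolding bounded_pos by fastforce
  have "H x \<le> M * norm x" for x
  proof (cases "x = 0")
    case False
    then have "H (x /\<^sub>R norm x) \<le> M"
      using M(2)[of "x /\<^sub>R norm x"] by simp
    then show ?thesis
      by (subst pos_gauge_sphere[OF assms]) (metis mult.commute mult_right_mono norm_ge_zero)
  qed (simp add: pos_gauge_zero[OF assms])
  with M(1) show ?thesis
    using that by (meson less_imp_le)
qed

text \<open>By compactness \<open>H\<close> attains its minimum on the unit sphere, where it is
  positive; homogeneity carries the bound to all \<open>x\<close>. This bound makes the unit ball of
  \<open>H\<close> bounded.\<close>

lemma pos_gauge_lower:
  fixes H :: "'a::euclidean_space \<Rightarrow> real"
  assumes "pos_gauge H"
  obtains m where "0 < m" "\<And>x. m * norm x \<le> H x"
proof -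
  have "sphere (0::'a) 1 \<noteq> {}"
    by simp
  then obtain x0 where x0: "x0 \<in> sphere 0 1" "\<And>x. x \<in> sphere 0 1 \<Longrightarrow> H x0 \<le> H x"
    using continuous_attains_inf[OF _ _ pos_gauge_continuous[OF assms], of "sphere 0 1"] by auto
  have "H x0 * norm x \<le> H x" for x
  proof (cases "x = 0")
    case False
    then have "H x0 \<le> H (x /\<^sub>R norm x)"
      using x0(2)[of "x /\<^sub>R norm x"] by simp
    then show ?thesis
      by (subst (2) pos_gauge_sphere[OF assms]) (metis mult.commute mult_right_mono norm_ge_zero)
  qed (simp add: pos_gauge_zero[OF assms])
  moreover have "0 < H x0"
    using x0(1) by (intro pos_gauge_pos[OF assms]) auto
  ultimately show ?thesis
    using that by blast
qed

text \<open>Subadditivity gives \<open>H x - H y \<le> H (x - y)\<close>, and the upper bound by the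
  norm applies. Exchanging \<open>x\<close> and \<open>y\<close> is harmless since the norm, unlike
  \<open>H\<close>, is even.\<close>

lemma pos_gauge_lipschitz:
  fixes H :: "'a::euclidean_space \<Rightarrow> real"
  assumes "pos_gauge H"
  obtains M where "0 \<le> M" "\<And>x y. \<bar>H x - H y\<bar> \<le> M * norm (x - y)"
proof -
  obtain M where M: "0 \<le> M" "\<And>x. H x \<le> M * norm x"
    using pos_gauge_upper[OF assms] by blast
  have "H x - H y \<le> M * norm (x - y)" for x y
    using pos_gauge_add[OF assms, of "x - y" y] M(2)[of "x - y"] by simp
  then have "\<bar>H x - H y\<bar> \<le> M * norm (x - y)" for x y
    by (metis abs_le_iff minus_diff_eq norm_minus_commute)
  with M(1) show ?thesis
    using that by blast
qed

section \<open>The unit ball of a gauge\<close>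

lemma convex_pos_gauge_sublevel:
  assumes "pos_gauge H"
  shows "convex {x. H x \<le> 1}"
proof -
  show ?thesis
    unfolding convex_alt
  proof (intro ballI allI impI CollectI)
    fix x y and u :: real
    assume "x \<in> {x. H x \<le> 1}" "y \<in> {x. H x \<le> 1}" "0 \<le> u \<and> u \<le> 1"
    then show "H ((1 - u) *\<^sub>R x + u *\<^sub>R y) \<le> 1"
      using convex_onD[OF pos_gauge_convex_on[OF assms], of u x y]
        convex_bound_le[of "H x" 1 "H y" "1 - u" u] by simp
  qed
qed

lemma compact_pos_gauge_sublevel:
  fixes H :: "'a::euclidean_space \<Rightarrow> real"
  assumes "pos_gauge H"
  shows "compact {x. H x \<le> 1}"
proof -
  obtain m where m: "0 < m" "\<And>x. m * norm x \<le> H x"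
    using pos_gauge_lower[OF assms] by blast
  have "norm x \<le> 1 / m" if "H x \<le> 1" for x
    using m(2)[of x] that \<open>0 < m\<close> by (simp add: field_simps)
  then have "bounded {x. H x \<le> 1}"
    unfolding bounded_iff by blast
  moreover have "closed {x. H x \<le> 1}"
    by (intro closed_Collect_le pos_gauge_continuous[OF assms] continuous_on_const)
  ultimately show ?thesis
    by (simp add: compact_eq_bounded_closed)
qed

text \<open>The strict sublevel set is open by continuity. Conversely, a point with
  \<open>H x \<ge> 1\<close> is not interior, since stretching it slightly away from the origin
  pushes \<open>H\<close> above 1.\<close>

lemma interior_pos_gauge_sublevel:
  fixes H :: "'a::euclidean_space \<Rightarrow> real"
  assumes "pos_gauge H"
  shows "interior {x. H x \<le> 1} = {x. H x < 1}"
proof (intro subset_antisym interior_maximal)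
  show "open {x. H x < 1}"
    by (intro open_Collect_less pos_gauge_continuous[OF assms] continuous_on_const)
  show "interior {x. H x \<le> 1} \<subseteq> {x. H x < 1}"
  proof
    fix x assume x: "x \<in> interior {x. H x \<le> 1}"
    show "x \<in> {x. H x < 1}"
    proof (rule ccontr)
      assume "x \<notin> {x. H x < 1}"
      then have ge: "H x \<ge> 1" by simp
      obtain e where e: "0 < e" "ball x e \<subseteq> {x. H x \<le> 1}"
        using x by (auto simp: mem_interior)
      \<comment> \<open>The stretch moves \<open>x\<close> by \<open>s * norm x\<close>, which this
        choice keeps at most \<open>e / 2\<close>; the added 1 keeps the denominator positive
        without a case distinction.\<close>
      define s where "s = e / (2 * (norm x + 1))"
      have s: "0 < s" unfolding s_def using e(1)
        by (intro divide_pos_pos) (auto simp: add_nonneg_pos)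
      have "norm (s *\<^sub>R x) = e / 2 * (norm x / (norm x + 1))"
        using e(1) by (simp add: s_def)
      also have "\<dots> \<le> e / 2 * 1"
        using e(1) by (intro mult_left_mono) (auto simp: divide_le_eq add_nonneg_pos)
      finally have "(1 + s) *\<^sub>R x \<in> ball x e"
        using e(1) by (simp add: dist_norm algebra_simps)
      then have "(1 + s) * H x \<le> 1"
        using e(2) s pos_gauge_scale[OF assms, of "1 + s" x] by auto
      with ge s show False
        by (smt (verit) mult_less_cancel_right1)
    qed
  qed
qed auto

lemma frontier_pos_gauge_sublevel:
  fixes H :: "'a::euclidean_space \<Rightarrow> real"
  assumes "pos_gauge H"
  shows "frontier {x. H x \<le> 1} = {x. H x = 1}"
  using compact_imp_closed[OF compact_pos_gauge_sublevel[OF assms]]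
  by (auto simp: frontier_def interior_pos_gauge_sublevel[OF assms] closure_closed)

text \<open>The Minkowski functional: \<open>H x\<close> is the infimum of the factors
  \<open>s\<close> for which \<open>x\<close> lies in the dilate of \<open>D\<close> by
  \<open>s\<close>. Convexity yields subadditivity, boundedness yields definiteness, and closedness
  recovers \<open>D\<close> from \<open>H\<close>.\<close>

lemma convex_body_pos_gauge:
  fixes D :: "'a::real_normed_vector set"
  assumes "convex D" "compact D" "0 \<in> interior D"
  obtains H where "pos_gauge H" "D = {x. H x \<le> 1}"
proof -
  define A where "A x = {s. 0 < s \<and> x /\<^sub>R s \<in> D}" for x
  define H where "H x = Inf (A x)" for x
  have zero: "0 \<in> D"
    using assms(3) interior_subset by blast
  obtain e where e: "0 < e" "cball 0 e \<subseteq> D"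
    using assms(3) by (auto simp: mem_interior_cball)
  obtain B where B: "0 < B" "\<And>x. x \<in> D \<Longrightarrow> norm x \<le> B"
    using compact_imp_bounded[OF assms(2)] unfolding bounded_pos by blast
  have bdd: "bdd_below (A x)" for x
    by (rule bdd_belowI[of _ 0]) (auto simp: A_def)
  \<comment> \<open>Dividing \<open>x\<close> by \<open>(norm x + e) / e\<close> brings it into the
    ball of radius \<open>e\<close> inside \<open>D\<close>; the summand \<open>e\<close> keeps the
    factor positive at \<open>x = 0\<close>.\<close>
  have ne: "A x \<noteq> {}" for x
  proof -
    have "x /\<^sub>R ((norm x + e) / e) \<in> cball 0 e"
      using e(1) by (simp add: divide_le_eq add_nonneg_pos mult_left_mono)
    then have "(norm x + e) / e \<in> A x"
      using e by (auto simp: A_def add_nonneg_pos intro!: divide_pos_pos)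
    then show ?thesis by blast
  qed
  \<comment> \<open>A larger factor moves the scaled point towards the origin, along a segment that
    stays in \<open>D\<close> by convexity. So \<open>A x\<close> is an upper ray, and
    \<open>lessD\<close> follows.\<close>
  have up: "s' \<in> A x" if "s \<in> A x" "s \<le> s'" for s s' x
  proof -
    have "(s / s') *\<^sub>R (x /\<^sub>R s) + (1 - s / s') *\<^sub>R 0 \<in> D"
      using that zero by (intro convexD[OF assms(1)]) (auto simp: A_def)
    then show ?thesis
      using that by (auto simp: A_def field_simps)
  qed
  have lessD: "s \<in> A x" if "H x < s" for s x
    using that up cInf_lessD[OF ne] unfolding H_def by (metis less_imp_le)
  have le: "H x \<le> s" if "s \<in> A x" for s x
    unfolding H_def using that bdd by (rule cInf_lower)
  have ge0: "norm x / B \<le> H x" for x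
    unfolding H_def
  proof (rule cInf_greatest[OF ne])
    fix s assume "s \<in> A x"
    then show "norm x / B \<le> s"
      using B(1) B(2)[of "x /\<^sub>R s"] by (auto simp: A_def field_simps)
  qed
  have add: "H (x + y) \<le> H x + H y" for x y
  proof (rule field_le_epsilon)
    fix d :: real assume d: "0 < d"
    define s s' where ss: "s = H x + d / 2" "s' = H y + d / 2"
    have A: "s \<in> A x" "s' \<in> A y"
      using d by (auto intro!: lessD simp: ss)
    then have pos: "0 < s" "0 < s'" by (auto simp: A_def)
    \<comment> \<open>The weights are chosen so that the two scaled points combine to exactly
      \<open>(x + y) /\<^sub>R (s + s')\<close>.\<close>
    have "(s / (s + s')) *\<^sub>R (x /\<^sub>R s) + (s' / (s + s')) *\<^sub>R (y /\<^sub>R s') \<in> D"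
      using A pos by (intro convexD[OF assms(1)]) (auto simp: A_def add_divide_distrib[symmetric])
    moreover have "s / (s + s') * inverse s = inverse (s + s')"
      "s' / (s + s') * inverse s' = inverse (s + s')"
      using pos by (simp_all add: divide_inverse)
    ultimately have "(x + y) /\<^sub>R (s + s') \<in> D"
      by (simp only: scaleR_scaleR scaleR_add_right)
    then have "H (x + y) \<le> s + s'"
      using pos by (intro le) (auto simp: A_def)
    then show "H (x + y) \<le> H x + H y + d"
      by (simp add: ss)
  qed
  \<comment> \<open>One inequality suffices: applied to \<open>inverse s\<close> and
    \<open>s *\<^sub>R x\<close>, it also gives the reverse one.\<close>
  have scale_le: "H (s *\<^sub>R x) \<le> s * H x" if "0 < s" for s x
  proof (rule field_le_epsilon)
    fix d :: real assume d: "0 < d"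
    define k where "k = H x + d / s"
    have "k \<in> A x"
      unfolding k_def using d that by (intro lessD) simp
    then have k: "0 < k" "x /\<^sub>R k \<in> D"
      by (auto simp: A_def)
    have "inverse (s * k) * s = inverse k"
      using that k(1) by (simp add: field_simps)
    with k(2) have "(s *\<^sub>R x) /\<^sub>R (s * k) \<in> D"
      by (simp only: scaleR_scaleR)
    with mult_pos_pos[OF that k(1)] have "s * k \<in> A (s *\<^sub>R x)"
      unfolding A_def by blast
    then have "H (s *\<^sub>R x) \<le> s * k"
      by (rule le)
    also have "s * k = s * H x + d"
      unfolding k_def using that by (simp add: distrib_left)
    finally show "H (s *\<^sub>R x) \<le> s * H x + d" .
  qed
  have scale: "H (s *\<^sub>R x) = s * H x" if "0 \<le> s" for s x
  proof (cases "s = 0")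
    case True
    have "d \<in> A 0" if "0 < d" for d
      using that zero by (auto simp: A_def)
    then have "H 0 \<le> 0"
      using le[of _ 0] by (simp add: field_le_epsilon)
    with ge0[of 0] True show ?thesis by simp
  next
    case False
    with that have "0 < s" by simp
    then have "s * H x \<le> H (s *\<^sub>R x)"
      using scale_le[of "inverse s" "s *\<^sub>R x"] by (simp add: field_simps)
    with scale_le[OF \<open>0 < s\<close>, of x] show ?thesis by simp
  qed
  have "0 < H x" if "x \<noteq> 0" for x
    using ge0[of x] B(1) that by (intro less_le_trans[OF _ ge0[of x]]) simp
  with add scale have "pos_gauge H"
    unfolding pos_gauge_def by blast
  moreover have "D = {x. H x \<le> 1}"
  proof (intro set_eqI iffI CollectI)
    fix x assume "x \<in> D"
    then show "H x \<le> 1"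
      by (intro le) (auto simp: A_def)
  next
    fix x assume "x \<in> {x. H x \<le> 1}"
    \<comment> \<open>The value \<open>H x = 1\<close> says only that factors above 1 are
      admissible, so \<open>x\<close> is reached as a limit of points of the closed set
      \<open>D\<close>.\<close>
    then have "1 + inverse (real (Suc n)) \<in> A x" for n
      by (intro lessD le_less_trans[of "H x" 1]) auto
    then have "\<And>n. x /\<^sub>R (1 + inverse (real (Suc n))) \<in> D"
      by (auto simp: A_def)
    moreover have "(\<lambda>n. x /\<^sub>R (1 + inverse (real (Suc n)))) \<longlonglongrightarrow> x /\<^sub>R (1 + 0)"
      by (intro tendsto_intros LIMSEQ_inverse_real_of_nat) auto
    ultimately have "x /\<^sub>R (1 + 0) \<in> D"
      by (rule closed_sequentially[OF compact_imp_closed[OF assms(2)]])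
    then show "x \<in> D" by simp
  qed
  ultimately show ?thesis
    using that by blast
qed

section \<open>Unit directions and polar coordinates\<close>

lemma inner_unit_dir: "v \<bullet> unit_dir t = v $ 1 * cos t + v $ 2 * sin t"
  by (simp add: unit_dir_def inner_vec_def sum_2)

lemma norm_unit_dir [simp]: "norm (unit_dir t) = 1"
  by (simp add: norm_eq_1 inner_unit_dir) (simp add: unit_dir_def power2_eq_square[symmetric])

lemma unit_dir_nonzero [simp]: "unit_dir t \<noteq> 0"
  by (metis norm_unit_dir norm_zero zero_neq_one)

lemma unit_dir_2pi [simp]: "unit_dir (2 * pi) = unit_dir 0"
  by (simp add: unit_dir_def)

lemma polar_unit_dir:
  obtains t where "t \<in> {0..2*pi}" "x = norm x *\<^sub>R unit_dir t"
proof (cases "x = 0")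
  case True
  then show ?thesis
    using that[of 0] by simp
next
  case False
  then have nz: "norm x \<noteq> 0"
    by simp
  have sq: "(norm x)\<^sup>2 = (x $ 1)\<^sup>2 + (x $ 2)\<^sup>2"
    unfolding power2_norm_eq_inner by (simp add: inner_vec_def sum_2 power2_eq_square)
  have "(x $ 1 / norm x)\<^sup>2 + (x $ 2 / norm x)\<^sup>2 = 1"
    using nz by (simp add: power_divide add_divide_distrib[symmetric] sq[symmetric] del: norm_eq_zero)
  then obtain t where t: "0 \<le> t" "t < 2 * pi" "x $ 1 / norm x = cos t" "x $ 2 / norm x = sin t"
    by (metis sincos_total_2pi)
  have "x = norm x *\<^sub>R unit_dir t"
    using False t(3,4)[symmetric] by (simp add: vec_eq_iff forall_2 unit_dir_def)
  with t(1,2) show ?thesis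
    using that[of t] by simp
qed

text \<open>The chord has length \<open>2 * \<bar>sin ((s - t) / 2)\<bar>\<close>, which is at most
  the length of the arc.\<close>

lemma unit_dir_lipschitz: "norm (unit_dir s - unit_dir t) \<le> \<bar>s - t\<bar>"
proof -
  have "(norm (unit_dir s - unit_dir t))\<^sup>2 = 2 - 2 * cos (s - t)"
    unfolding power2_norm_eq_inner inner_unit_dir
    using sin_cos_squared_add[of s] sin_cos_squared_add[of t]
    by (simp add: unit_dir_def cos_diff inner_vec_def sum_2 power2_eq_square algebra_simps)
  also have "\<dots> = 4 * (sin ((s - t) / 2))\<^sup>2"
    using cos_double_sin[of "(s - t) / 2"] by (simp add: diff_divide_distrib)
  also have "\<dots> \<le> 4 * ((s - t) / 2)\<^sup>2"
    using abs_sin_x_le_abs_x[of "(s - t) / 2"] by (simp only: abs_le_square_iff)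
  also have "\<dots> = \<bar>s - t\<bar>\<^sup>2"
    by (simp add: power_divide)
  finally show ?thesis
    by (rule power2_le_imp_le) simp
qed

lemma continuous_on_unit_dir [continuous_intros]:
  assumes "continuous_on S f"
  shows "continuous_on S (\<lambda>x. unit_dir (f x))"
proof -
  have "1-lipschitz_on UNIV unit_dir"
    by (rule lipschitz_onI) (auto simp: dist_norm unit_dir_lipschitz)
  then have "continuous_on UNIV unit_dir"
    by (rule lipschitz_on_continuous_on)
  then show ?thesis
    using assms by (rule continuous_on_compose2) auto
qed

section \<open>Radial functions of gauges and perturbation by a linear form\<close>

text \<open>The frontier is the level set \<open>H = 1\<close>, and on a ray homogeneity turns this
  into \<open>s * H (unit_dir t) = 1\<close>. This equation has one solution, so the definite
  description is well defined.\<close>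

lemma radial_function_pos_gauge:
  assumes "pos_gauge H"
  shows "radial_function {x. H x \<le> 1} = (\<lambda>t\<in>{0..2*pi}. 1 / H (unit_dir t))"
  unfolding radial_function_def
proof (rule restrict_ext)
  fix t :: real
  have pos: "0 < H (unit_dir t)"
    by (intro pos_gauge_pos[OF assms]) simp
  have "(THE p. p \<in> frontier {x. H x \<le> 1} \<and> (\<exists>s\<ge>0. p = s *\<^sub>R unit_dir t))
      = (1 / H (unit_dir t)) *\<^sub>R unit_dir t"
    unfolding frontier_pos_gauge_sublevel[OF assms]
    using pos
    by (intro the_equality)
       (auto simp: pos_gauge_scale[OF assms] nonzero_eq_divide_eq intro!: exI[of _ "1 / H (unit_dir t)"])
  then show "dist 0 (THE p. p \<in> frontier {x. H x \<le> 1} \<and> (\<exists>s\<ge>0. p = s *\<^sub>R unit_dir t))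
      = 1 / H (unit_dir t)"
    using pos by simp
qed

lemma starshaped_set_pos_gauge:
  assumes "pos_gauge H"
  shows "starshaped_set (\<lambda>t\<in>{0..2*pi}. 1 / H (unit_dir t)) = {x. H x \<le> 1}"
proof (intro set_eqI iffI)
  fix x assume "x \<in> starshaped_set (\<lambda>t\<in>{0..2*pi}. 1 / H (unit_dir t))"
  then obtain s t where "x = s *\<^sub>R unit_dir t" "0 \<le> s" "s \<le> 1 / H (unit_dir t)"
    unfolding starshaped_set_def by auto
  then show "x \<in> {x. H x \<le> 1}"
    using pos_gauge_pos[OF assms, of "unit_dir t"]
    by (simp add: pos_gauge_scale[OF assms] field_simps)
next
  fix x assume x: "x \<in> {x. H x \<le> 1}"
  obtain t where t: "t \<in> {0..2*pi}" "x = norm x *\<^sub>R unit_dir t"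
    using polar_unit_dir by blast
  then have "norm x * H (unit_dir t) \<le> 1"
    using x pos_gauge_scale[OF assms, of "norm x" "unit_dir t"] by simp
  then have "norm x \<le> 1 / H (unit_dir t)"
    using pos_gauge_pos[OF assms, of "unit_dir t"] by (simp add: field_simps)
  with t show "x \<in> starshaped_set (\<lambda>t\<in>{0..2*pi}. 1 / H (unit_dir t))"
    unfolding starshaped_set_def by (intro CollectI exI[of _ "norm x"] exI[of _ t]) auto
qed

lemma radial_functions_pos_gauge:
  assumes "pos_gauge H"
  shows "(\<lambda>t\<in>{0..2*pi}. 1 / H (unit_dir t)) \<in> radial_functions"
proof -
  have pos: "0 < H (unit_dir t)" for t
    by (intro pos_gauge_pos[OF assms]) simp
  have "continuous_on {0..2*pi} (\<lambda>t. H (unit_dir t))"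
    by (rule continuous_on_compose2[OF pos_gauge_continuous[OF assms, of UNIV]])
       (auto intro!: continuous_intros)
  then have "continuous_on {0..2*pi} (\<lambda>t. 1 / H (unit_dir t))"
    using pos by (intro continuous_intros) (auto simp: less_imp_neq[symmetric])
  then have "continuous_on {0..2*pi} (\<lambda>t\<in>{0..2*pi}. 1 / H (unit_dir t))"
    by (rule continuous_on_eq) auto
  then show ?thesis
    using pos by (auto simp: radial_functions_def)
qed

text \<open>A linear summand respects subadditivity and homogeneity; only positivity can be lost,
  and by homogeneity it need only be checked on the unit circle.\<close>

lemma pos_gauge_affine:
  assumes "pos_gauge H" and "0 < a"
    and "\<And>t. t \<in> {0..2*pi} \<Longrightarrow> 0 < a * H (unit_dir t) + v \<bullet> unit_dir t"
  shows "pos_gauge (\<lambda>x. a * H x + v \<bullet> x)"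
  unfolding pos_gauge_def
proof (intro conjI allI impI)
  fix x y :: "real ^ 2"
  show "a * H (x + y) + v \<bullet> (x + y) \<le> a * H x + v \<bullet> x + (a * H y + v \<bullet> y)"
    using mult_left_mono[OF pos_gauge_add[OF assms(1), of x y], of a] \<open>0 < a\<close>
    by (simp add: algebra_simps inner_add_right)
next
  fix s :: real and x :: "real ^ 2"
  assume "0 \<le> s"
  then show "a * H (s *\<^sub>R x) + v \<bullet> (s *\<^sub>R x) = s * (a * H x + v \<bullet> x)"
    by (simp add: pos_gauge_scale[OF assms(1)] algebra_simps)
next
  fix x :: "real ^ 2"
  assume "x \<noteq> 0"
  obtain t where t: "t \<in> {0..2*pi}" "x = norm x *\<^sub>R unit_dir t"
    using polar_unit_dir by blast
  have "0 < norm x * (a * H (unit_dir t) + v \<bullet> unit_dir t)"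
    using assms(3)[OF t(1)] \<open>x \<noteq> 0\<close> by simp
  also have "\<dots> = a * H x + v \<bullet> x"
    using pos_gauge_scale[OF assms(1), of "norm x" "unit_dir t"]
    by (subst (2 3) t(2)) (simp add: algebra_simps)
  finally show "0 < a * H x + v \<bullet> x" .
qed

section \<open>Existence of the Santalo point\<close>

text \<open>On an interval of length \<open>h t0\<close> ending at \<open>t0\<close>, the Lipschitz bound gives
  \<open>h \<le> (1 + L) h t0\<close>.\<close>

lemma inverse_square_blowup:
  fixes h :: "real \<Rightarrow> real"
  assumes lip: "\<And>s t. \<bar>h s - h t\<bar> \<le> L * \<bar>s - t\<bar>" and "0 \<le> L"
    and pos: "\<And>t. t \<in> {0..2*pi} \<Longrightarrow> 0 < h t"
    and cont: "continuous_on {0..2*pi} h"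
    and t0: "t0 \<in> {0..2*pi}" and le: "h t0 \<le> pi"
  shows "1 / ((1 + L)\<^sup>2 * h t0) \<le> integral {0..2*pi} (\<lambda>t. 1 / (h t)\<^sup>2)"
proof -
  define d where "d = h t0"
  have d: "0 < d" "d \<le> pi"
    using pos t0 le by (auto simp: d_def)
  \<comment> \<open>The interval extends to the right of \<open>t0\<close> in the first half of the
    period and to the left otherwise; as \<open>d \<le> pi\<close>, it stays inside the period
    either way.\<close>
  define a where "a = (if t0 \<le> pi then t0 else t0 - d)"
  have sub: "{a..a + d} \<subseteq> {0..2*pi}" and near: "\<And>t. t \<in> {a..a + d} \<Longrightarrow> \<bar>t - t0\<bar> \<le> d"
    using t0 d by (auto simp: a_def split: if_splits)
  have int: "(\<lambda>t. 1 / (h t)\<^sup>2) integrable_on {x..y}" if "{x..y} \<subseteq> {0..2*pi}" for x y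
  proof (intro integrable_continuous_interval continuous_intros)
    show "continuous_on {x..y} h"
      using cont that continuous_on_subset by blast
    show "\<forall>t\<in>{x..y}. (h t)\<^sup>2 \<noteq> 0"
      using pos that by fastforce
  qed
  have "1 / ((1 + L)\<^sup>2 * d) = integral {a..a + d} (\<lambda>t. 1 / ((1 + L) * d)\<^sup>2)"
    using d by (simp add: power2_eq_square)
  also have "\<dots> \<le> integral {a..a + d} (\<lambda>t. 1 / (h t)\<^sup>2)"
  proof (intro integral_le int sub)
    fix t assume t: "t \<in> {a..a + d}"
    then have "0 < h t"
      using pos sub by blast
    moreover have "h t \<le> d + L * \<bar>t - t0\<bar>"
      using lip[of t t0] by (simp add: d_def)
    then have "h t \<le> (1 + L) * d"
      using mult_left_mono[OF near[OF t] \<open>0 \<le> L\<close>] by (simp add: algebra_simps)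
    moreover have "0 < (1 + L) * d"
      using d(1) \<open>0 \<le> L\<close> by simp
    ultimately show "1 / ((1 + L) * d)\<^sup>2 \<le> 1 / (h t)\<^sup>2"
      by (intro divide_left_mono power_mono mult_pos_pos[of "_ ^ 2"] zero_less_power) auto
  qed auto
  also have "\<dots> \<le> integral {0..2*pi} (\<lambda>t. 1 / (h t)\<^sup>2)"
    by (intro integral_subset_le sub int) auto
  finally show ?thesis
    by (simp add: d_def)
qed

lemma DERIV_inverse_square_affine:
  fixes f g :: real
  assumes nz: "f + x * g \<noteq> 0"
  shows "((\<lambda>x. 1 / (f + x * g)\<^sup>2) has_field_derivative
        - 2 * g / (f + x * g) ^ 3) (at x within U)"
proof -
  have eq: "- (inverse (y\<^sup>2) * (2 * (g * y)) * inverse (y\<^sup>2)) = - 2 * g / y ^ 3"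
    if "y \<noteq> 0" for y
    using that by (simp add: divide_simps power2_eq_square power3_eq_cube)
  have "((\<lambda>x. f + x * g) has_field_derivative g) (at x within U)"
    by (auto intro!: derivative_eq_intros)
  from DERIV_inverse_fun[OF DERIV_power[OF this, of 2]] nz
  have "((\<lambda>x. inverse ((f + x * g)\<^sup>2)) has_field_derivative
     - (inverse ((f + x * g)\<^sup>2) * (2 * (g * (f + x * g))) * inverse ((f + x * g)\<^sup>2))) (at x within U)"
    by (simp add: numeral_2_eq_2 mult_ac)
  then show ?thesis
    unfolding eq[OF nz] unfolding inverse_eq_divide .
qed

text \<open>First-order condition in the direction \<open>g\<close>: differentiation under the
  integral sign gives \<open>-2\<close> times the claimed integral as the derivative at 0, where the
  minimum is attained. Comparison is assumed only with perturbations that keep the denominator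
  positive.\<close>

lemma integral_inverse_square_critical:
  fixes f g :: "real \<Rightarrow> real"
  assumes cf: "continuous_on {a..b} f" and cg: "continuous_on {a..b} g"
    and d: "0 < d" and ge: "\<And>t. t \<in> {a..b} \<Longrightarrow> d \<le> f t"
    and g: "\<And>t. t \<in> {a..b} \<Longrightarrow> \<bar>g t\<bar> \<le> B" and B: "0 < B"
    and min: "\<And>x. (\<And>t. t \<in> {a..b} \<Longrightarrow> 0 < f t + x * g t) \<Longrightarrow>
      integral {a..b} (\<lambda>t. 1 / (f t)\<^sup>2) \<le> integral {a..b} (\<lambda>t. 1 / (f t + x * g t)\<^sup>2)"
  shows "integral {a..b} (\<lambda>t. g t / (f t) ^ 3) = 0"
proof -
  \<comment> \<open>For \<open>\<bar>x\<bar> < d / B\<close> the perturbation \<open>x * g t\<close>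
    is smaller than \<open>d \<le> f t\<close>, so the denominator stays positive.\<close>
  define U where "U = ball (0::real) (d / B)"
  have U: "0 \<in> U" "convex U" "open U"
    using d B by (auto simp: U_def)
  have pos: "0 < f t + x * g t" if "x \<in> U" "t \<in> {a..b}" for x t
  proof -
    have "\<bar>x * g t\<bar> \<le> \<bar>x\<bar> * B"
      unfolding abs_mult using g[OF that(2)] by (intro mult_left_mono) auto
    also have "\<dots> < d"
      using that(1) B by (simp add: U_def field_simps)
    finally show ?thesis
      using ge[OF that(2)] by simp
  qed
  have "((\<lambda>x. integral (cbox a b) (\<lambda>t. 1 / (f t + x * g t)\<^sup>2)) has_field_derivative
      integral (cbox a b) (\<lambda>t. - 2 * g t / (f t + 0 * g t) ^ 3)) (at 0 within U)"
  proof (rule leibniz_rule_field_derivative)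
    fix x t assume "x \<in> U" "t \<in> cbox a b"
    then have "f t + x * g t \<noteq> 0"
      using pos[of x t] by auto
    then show "((\<lambda>x. 1 / (f t + x * g t)\<^sup>2) has_field_derivative
        - 2 * g t / (f t + x * g t) ^ 3) (at x within U)"
      by (rule DERIV_inverse_square_affine)
  next
    fix x assume "x \<in> U"
    then have "\<forall>t\<in>{a..b}. (f t + x * g t)\<^sup>2 \<noteq> 0"
      by (simp add: pos less_imp_neq[THEN not_sym])
    then show "(\<lambda>t. 1 / (f t + x * g t)\<^sup>2) integrable_on cbox a b"
      unfolding cbox_interval
      by (intro integrable_continuous_interval continuous_intros cf cg)
  next
    show "continuous_on (U \<times> cbox a b) (\<lambda>(x, t). - 2 * g t / (f t + x * g t) ^ 3)"
      unfolding split_beta cbox_interval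
    proof (intro continuous_intros continuous_on_compose2[OF cg]
        continuous_on_compose2[OF cf])
      show "\<forall>z\<in>U \<times> {a..b}. (f (snd z) + fst z * g (snd z)) ^ 3 \<noteq> 0"
      proof
        fix z assume "z \<in> U \<times> {a..b}"
        then have "0 < f (snd z) + fst z * g (snd z)"
          by (intro pos) auto
        then show "(f (snd z) + fst z * g (snd z)) ^ 3 \<noteq> 0"
          by simp
      qed
    qed auto
  qed (use U in auto)
  then have der: "((\<lambda>x. integral {a..b} (\<lambda>t. 1 / (f t + x * g t)\<^sup>2)) has_real_derivative
      integral {a..b} (\<lambda>t. - 2 * g t / (f t) ^ 3)) (at 0)"
    by (simp only: at_within_open[OF U(1,3)] cbox_interval mult_zero_left add_0_right)
  have "integral {a..b} (\<lambda>t. - 2 * g t / (f t) ^ 3) = 0"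
  proof (rule DERIV_local_min[OF der])
    show "0 < d / B" using d B by simp
    show "\<forall>x. \<bar>0 - x\<bar> < d / B \<longrightarrow> integral {a..b} (\<lambda>t. 1 / (f t + 0 * g t)\<^sup>2)
        \<le> integral {a..b} (\<lambda>t. 1 / (f t + x * g t)\<^sup>2)"
    proof (intro allI impI)
      fix x :: real assume "\<bar>0 - x\<bar> < d / B"
      then have "x \<in> U" by (simp add: U_def)
      then have "integral {a..b} (\<lambda>t. 1 / (f t)\<^sup>2) \<le> integral {a..b} (\<lambda>t. 1 / (f t + x * g t)\<^sup>2)"
        by (intro min pos)
      then show "integral {a..b} (\<lambda>t. 1 / (f t + 0 * g t)\<^sup>2)
        \<le> integral {a..b} (\<lambda>t. 1 / (f t + x * g t)\<^sup>2)"
        by (simp only: mult_zero_left add_0_right)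
    qed
  qed
  moreover have "integral {a..b} (\<lambda>t. - 2 * g t / (f t) ^ 3) = - 2 * integral {a..b} (\<lambda>t. g t / (f t) ^ 3)"
    unfolding integral_mult_right[symmetric] by (intro integral_cong) simp
  ultimately show ?thesis by simp
qed

text \<open>\<open>F\<close> is minimised over the compact set \<open>C\<close> of those
  \<open>v\<close> whose denominator is at least \<delta>. Outside \<open>C\<close> the blow-up
  makes \<open>F\<close> exceed \<open>F 0\<close>, so the minimum is one over all of \<Omega>, and
  every \<open>w\<close> is an admissible direction for the critical point equation.\<close>

lemma santalo_point:
  fixes p :: "real \<Rightarrow> real"
  assumes lip: "\<And>s t. \<bar>p s - p t\<bar> \<le> L * \<bar>s - t\<bar>" and "0 \<le> L"
    and pos: "\<And>t. t \<in> {0..2*pi} \<Longrightarrow> 0 < p t"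
  obtains v where "\<And>t. t \<in> {0..2*pi} \<Longrightarrow> 0 < p t + v \<bullet> unit_dir t"
    "\<And>w. integral {0..2*pi} (\<lambda>t. (w \<bullet> unit_dir t) / (p t + v \<bullet> unit_dir t) ^ 3) = 0"
proof -
  define I where "I = {0..2*pi}"
  have I: "compact I" "I \<noteq> {}" by (auto simp: I_def)
  have "L-lipschitz_on UNIV p"
    using lip \<open>0 \<le> L\<close> by (intro lipschitz_onI) (auto simp: dist_real_def)
  then have cp: "continuous_on S p" for S
    using lipschitz_on_continuous_on continuous_on_subset by blast
  define h where "h v t = p t + v \<bullet> unit_dir t" for v t
  have ch: "continuous_on S (h v)" for S v
    unfolding h_def by (intro continuous_intros cp)
  define F where "F v = integral I (\<lambda>t. 1 / (h v t)\<^sup>2)" for v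
  define \<Omega> where "\<Omega> = {v. \<forall>t\<in>I. 0 < h v t}"
  obtain P where P: "\<And>t. t \<in> I \<Longrightarrow> p t \<le> P"
    using continuous_attains_sup[OF I cp] by blast
  obtain m where m: "0 < m" "\<And>t. t \<in> I \<Longrightarrow> m \<le> p t"
    using continuous_attains_inf[OF I cp] pos unfolding I_def by blast
  \<comment> \<open>In the direction \<open>t\<close> opposite to \<open>v\<close> the denominator
    is \<open>p t - norm v\<close>, so its positivity bounds \<open>v\<close>.\<close>
  have bound: "norm v \<le> P" if "v \<in> \<Omega>" for v
  proof -
    obtain t where t: "t \<in> {0..2*pi}" "- v = norm (- v) *\<^sub>R unit_dir t"
      using polar_unit_dir by blast
    have "v \<bullet> unit_dir t = - ((- v) \<bullet> unit_dir t)"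
      by simp
    also have "\<dots> = - norm v"
      by (subst t(2)) (simp add: norm_eq_1[symmetric])
    finally show ?thesis
      using that t(1) P[of t] by (auto simp: \<Omega>_def h_def I_def dest!: bspec[of _ _ t])
  qed
  have "0 \<in> \<Omega>" using pos by (simp add: \<Omega>_def h_def I_def)
  then have "0 \<le> P" using bound[of 0] by simp
  \<comment> \<open>A Lipschitz constant for \<open>h v\<close> that is uniform in \<open>v\<close>,
    thanks to the bound on \<Omega>.\<close>
  define \<Lambda> where "\<Lambda> = L + P"
  have hlip: "\<bar>h v s - h v t\<bar> \<le> \<Lambda> * \<bar>s - t\<bar>" if "v \<in> \<Omega>" for v s t
  proof -
    have "\<bar>v \<bullet> (unit_dir s - unit_dir t)\<bar> \<le> norm v * norm (unit_dir s - unit_dir t)"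
      by (rule Cauchy_Schwarz_ineq2)
    also have "\<dots> \<le> P * \<bar>s - t\<bar>"
      using bound[OF that] \<open>0 \<le> P\<close> unit_dir_lipschitz by (intro mult_mono) auto
    finally show ?thesis
      using lip[of s t] by (simp add: h_def \<Lambda>_def inner_diff_right algebra_simps)
  qed
  have \<Lambda>: "0 \<le> \<Lambda>" using \<open>0 \<le> L\<close> \<open>0 \<le> P\<close> by (simp add: \<Lambda>_def)
  have "(\<lambda>t. 1 / (h 0 t)\<^sup>2) integrable_on {0..2*pi}"
    using \<open>0 \<in> \<Omega>\<close> unfolding \<Omega>_def I_def
    by (intro integrable_continuous_interval continuous_intros ch) fastforce
  then have F0: "0 \<le> F 0"
    unfolding F_def I_def by (rule integral_nonneg) simp
  \<comment> \<open>The bound by \<open>m\<close> puts 0 into \<open>C\<close>, the bound by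
    \<open>pi\<close> lets the blow-up estimate apply, and the last term makes that estimate exceed
    \<open>F 0 + 1\<close>.\<close>
  define \<delta> where "\<delta> = min (min m pi) (1 / ((1 + \<Lambda>)\<^sup>2 * (F 0 + 1)))"
  have \<delta>: "0 < \<delta>" using m(1) \<Lambda> F0 by (simp add: \<delta>_def)
  define C where "C = {v. \<forall>t\<in>I. \<delta> \<le> h v t}"
  have "C \<subseteq> \<Omega>" using \<delta> by (force simp: C_def \<Omega>_def)
  have outside: "F 0 < F v" if v: "v \<in> \<Omega>" "v \<notin> C" for v
  proof -
    obtain t0 where t0: "t0 \<in> I" "h v t0 < \<delta>"
      using v by (force simp: C_def)
    have pos0: "0 < h v t0"
      using v(1) t0(1) by (auto simp: \<Omega>_def)
    have "(1 + \<Lambda>)\<^sup>2 * h v t0 < (1 + \<Lambda>)\<^sup>2 * (1 / ((1 + \<Lambda>)\<^sup>2 * (F 0 + 1)))"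
      using t0(2) \<Lambda> by (intro mult_strict_left_mono) (auto simp: \<delta>_def)
    also have "\<dots> = 1 / (F 0 + 1)"
      using \<Lambda> by simp
    finally have "F 0 + 1 < 1 / ((1 + \<Lambda>)\<^sup>2 * h v t0)"
      using pos0 F0 \<Lambda> by (simp add: field_simps)
    also have "\<dots> \<le> F v"
      unfolding F_def I_def
      using v(1) t0 hlip[OF v(1)] \<Lambda> ch
      by (intro inverse_square_blowup) (auto simp: \<Omega>_def I_def \<delta>_def)
    finally show ?thesis by simp
  qed
  have "compact C"
  proof -
    have "bounded C"
      using bound \<open>C \<subseteq> \<Omega>\<close> unfolding bounded_iff by blast
    moreover have "closed C"
      unfolding C_def Collect_ball_eq h_def
      by (intro closed_INT ballI closed_Collect_le continuous_intros)
    ultimately show ?thesis by (simp add: compact_eq_bounded_closed)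
  qed
  moreover have "0 \<in> C"
    using m by (force simp: C_def h_def \<delta>_def)
  moreover have "continuous_on C F"
  proof -
    have "continuous_on (C \<times> cbox 0 (2*pi)) (\<lambda>(v, t). 1 / (h v t)\<^sup>2)"
      unfolding split_beta h_def
    proof (intro continuous_intros continuous_on_compose2[OF cp[of UNIV]])
      show "\<forall>z\<in>C \<times> cbox 0 (2*pi). (p (snd z) + fst z \<bullet> unit_dir (snd z))\<^sup>2 \<noteq> 0"
      proof
        fix z assume "z \<in> C \<times> cbox 0 (2*pi)"
        then have "0 < h (fst z) (snd z)"
          using \<open>C \<subseteq> \<Omega>\<close> by (auto simp: \<Omega>_def I_def)
        then show "(p (snd z) + fst z \<bullet> unit_dir (snd z))\<^sup>2 \<noteq> 0"
          by (simp add: h_def)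
      qed
    qed auto
    from integral_continuous_on_param[OF this] show ?thesis
      by (simp add: F_def I_def)
  qed
  ultimately obtain v where v: "v \<in> C" "\<And>w. w \<in> C \<Longrightarrow> F v \<le> F w"
    using continuous_attains_inf[of C F] by blast
  then have "F v \<le> F 0"
    using \<open>0 \<in> C\<close> by blast
  then have min: "F v \<le> F w" if "w \<in> \<Omega>" for w
    using that v(2) outside by (meson less_imp_le order_trans)
  show ?thesis
  proof (rule that)
    fix t assume "t \<in> {0..2*pi}"
    then show "0 < p t + v \<bullet> unit_dir t"
      using v(1) \<open>C \<subseteq> \<Omega>\<close> by (auto simp: \<Omega>_def h_def I_def)
  next
    fix w :: "real ^ 2"
    have "integral {0..2*pi} (\<lambda>t. (w \<bullet> unit_dir t) / (h v t) ^ 3) = 0"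
    proof (rule integral_inverse_square_critical)
      show "0 < \<delta>" by fact
      show "continuous_on {0..2*pi} (h v)" by (rule ch)
      show "continuous_on {0..2*pi} (\<lambda>t. w \<bullet> unit_dir t)" by (intro continuous_intros)
      show "\<delta> \<le> h v t" if "t \<in> {0..2*pi}" for t
        using v(1) that by (simp add: C_def I_def)
      \<comment> \<open>The summand 1 keeps the bound strictly positive when
        \<open>w = 0\<close>.\<close>
      show "\<bar>w \<bullet> unit_dir t\<bar> \<le> norm w + 1" for t
        using Cauchy_Schwarz_ineq2[of w "unit_dir t"] by simp
      show "0 < norm w + 1"
        by (simp add: add_nonneg_pos)
      fix x assume x: "\<And>t. t \<in> {0..2*pi} \<Longrightarrow> 0 < h v t + x * (w \<bullet> unit_dir t)"
      have eq: "h v t + x * (w \<bullet> unit_dir t) = h (v + x *\<^sub>R w) t" for t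
        by (simp add: h_def inner_add_left)
      show "integral {0..2*pi} (\<lambda>t. 1 / (h v t)\<^sup>2)
          \<le> integral {0..2*pi} (\<lambda>t. 1 / (h v t + x * (w \<bullet> unit_dir t))\<^sup>2)"
        using min[of "v + x *\<^sub>R w"] x unfolding eq by (simp add: F_def \<Omega>_def I_def)
    qed
    then show "integral {0..2*pi} (\<lambda>t. (w \<bullet> unit_dir t) / (p t + v \<bullet> unit_dir t) ^ 3) = 0"
      by (simp add: h_def)
  qed
qed

section \<open>Strict minimality of feasible functions of the required form\<close>

text \<open>Since \<open>2s\<^sup>3 - 3s\<^sup>2r + r\<^sup>3 = (s - r)\<^sup>2(2s + r)\<close>, integrating the inequality
  \<open>s\<^sup>3/r \<ge> (3s\<^sup>2 - r\<^sup>2)/2\<close> gives the minimality of \<open>r\<close>; the left-hand side is \<open>a\<close> times the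
  objective because of the moment constraints.\<close>

lemma VP_form_minimal:
  assumes r0: "continuous_on {0..2*pi} r\<^sub>0" "\<And>t. t \<in> {0..2*pi} \<Longrightarrow> 0 < r\<^sub>0 t"
    and r: "r \<in> radial_functions" "VP_constraints r"
    and form: "0 < a" "\<And>t. t \<in> {0..2*pi} \<Longrightarrow> 1 / r t = a / r\<^sub>0 t + b * cos t + c * sin t"
    and s: "s \<in> radial_functions" "VP_constraints s"
  shows "2 \<le> a * VP_objective r\<^sub>0 s" "a * VP_objective r\<^sub>0 s = 2 \<longleftrightarrow> s = r"
proof -
  have rp: "0 < r t" and sp: "0 < s t" if "t \<in> {0..2*pi}" for t
    using r(1) s(1) that by (auto simp: radial_functions_def PiE_def Pi_def)
  have cr: "continuous_on {0..2*pi} r" and cs: "continuous_on {0..2*pi} s"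
    using r(1) s(1) by (auto simp: radial_functions_def)
  have nz: "\<forall>t\<in>{0..2*pi}. r t \<noteq> 0" "\<forall>t\<in>{0..2*pi}. r\<^sub>0 t \<noteq> 0"
    using rp r0(2) by force+
  define g where "g t = (s t - r t)\<^sup>2 * (2 * s t + r t) / (2 * r t)" for t
  have cg: "continuous_on {0..2*pi} g"
    unfolding g_def using nz by (intro continuous_intros cr cs) auto
  have g0: "0 \<le> g t" if "t \<in> {0..2*pi}" for t
    using rp[OF that] sp[OF that] unfolding g_def by simp
  have hi: "(f has_integral integral {0..2*pi} f) {0..2*pi}"
    if "continuous_on {0..2*pi} f" for f :: "real \<Rightarrow> real"
    using that by (intro integrable_integral integrable_continuous_interval)
  have "((\<lambda>t. a * (s t ^ 3 / r\<^sub>0 t) + b * (s t ^ 3 * cos t) + c * (s t ^ 3 * sin t)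
        - 3 / 2 * (s t)\<^sup>2 + 1 / 2 * (r t)\<^sup>2) has_integral
      a * integral {0..2*pi} (\<lambda>t. s t ^ 3 / r\<^sub>0 t) + b * integral {0..2*pi} (\<lambda>t. s t ^ 3 * cos t)
        + c * integral {0..2*pi} (\<lambda>t. s t ^ 3 * sin t)
        - 3 / 2 * integral {0..2*pi} (\<lambda>t. (s t)\<^sup>2) + 1 / 2 * integral {0..2*pi} (\<lambda>t. (r t)\<^sup>2)) {0..2*pi}"
    using nz by (intro has_integral_add has_integral_diff has_integral_mult_right hi
      continuous_intros cr cs r0(1)) auto
  \<comment> \<open>The moments of \<open>s\<close> vanish and both square integrals equal 2, so the
    last two terms contribute \<open>- 3 + 1 = - 2\<close>.\<close>
  then have "((\<lambda>t. a * (s t ^ 3 / r\<^sub>0 t) + b * (s t ^ 3 * cos t) + c * (s t ^ 3 * sin t)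
        - 3 / 2 * (s t)\<^sup>2 + 1 / 2 * (r t)\<^sup>2) has_integral a * VP_objective r\<^sub>0 s - 2) {0..2*pi}"
    using r(2) s(2) by (simp add: VP_constraints_def VP_objective_def)
  moreover have "a * (s t ^ 3 / r\<^sub>0 t) + b * (s t ^ 3 * cos t) + c * (s t ^ 3 * sin t)
      - 3 / 2 * (s t)\<^sup>2 + 1 / 2 * (r t)\<^sup>2 = g t" if "t \<in> {0..2*pi}" for t
  proof -
    have "a * (s t ^ 3 / r\<^sub>0 t) + b * (s t ^ 3 * cos t) + c * (s t ^ 3 * sin t) = s t ^ 3 * (1 / r t)"
      unfolding form(2)[OF that] by (simp add: algebra_simps)
    moreover have "x ^ 3 * (1 / y) - 3 / 2 * x\<^sup>2 + 1 / 2 * y\<^sup>2 = (x - y)\<^sup>2 * (2 * x + y) / (2 * y)"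
      if "0 < y" for x y :: real
      using that by (simp add: field_simps power2_eq_square power3_eq_cube)
    ultimately show ?thesis
      using rp[OF that] by (simp add: g_def)
  qed
  ultimately have "(g has_integral a * VP_objective r\<^sub>0 s - 2) {0..2*pi}"
    by (rule has_integral_eq[rotated])
  then have int: "integral {0..2*pi} g = a * VP_objective r\<^sub>0 s - 2"
    by (rule integral_unique)
  moreover have "0 \<le> integral {0..2*pi} g"
    using g0 cg by (intro integral_nonneg integrable_continuous_interval)
  ultimately show "2 \<le> a * VP_objective r\<^sub>0 s" by simp
  have g_eq_0: "g t = 0 \<longleftrightarrow> s t = r t" if "t \<in> {0..2*pi}" for t
    using rp[OF that] sp[OF that] by (auto simp: g_def)
  \<comment> \<open>Continuity upgrades a vanishing integral of the nonnegative \<open>g\<close> to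
    vanishing everywhere; extensionality then turns agreement on the interval into
    \<open>s = r\<close>.\<close>
  have "integral {0..2*pi} g = 0 \<longleftrightarrow> (\<forall>t\<in>{0..2*pi}. g t = 0)"
    by (rule integral_eq_0_iff[OF cg _ g0]) simp_all
  then have "a * VP_objective r\<^sub>0 s = 2 \<longleftrightarrow> (\<forall>t\<in>{0..2*pi}. g t = 0)"
    by (simp only: int) linarith
  also have "\<dots> \<longleftrightarrow> (\<forall>t\<in>{0..2*pi}. s t = r t)"
    using g_eq_0 by (rule ball_cong[OF refl])
  also have "\<dots> \<longleftrightarrow> s = r"
    using r(1) s(1) by (auto simp: radial_functions_def intro: PiE_ext)
  finally show "a * VP_objective r\<^sub>0 s = 2 \<longleftrightarrow> s = r" .
qed

section \<open>Construction of the solution from the Santalo point\<close>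

theorem theorem1p1:
  fixes D :: "(real ^ 2) set" and r\<^sub>0 :: "real \<Rightarrow> real"
  assumes "convex D" and "compact D" and "0 \<in> interior D"
    and "r\<^sub>0 = radial_function D"
  shows "\<exists>r. VP_solution r\<^sub>0 r \<and> (\<forall>s. VP_solution r\<^sub>0 s \<longrightarrow> s = r) \<and>
           (\<exists>K. convex K \<and> compact K \<and> 0 \<in> interior K \<and>
                K = starshaped_set r \<and> r = radial_function K) \<and>
           VP_form r\<^sub>0 r \<and>
           (\<forall>s\<in>radial_functions. VP_form r\<^sub>0 s \<and> VP_constraints s \<longrightarrow> s = r)"
proof -
  obtain H where H: "pos_gauge H" "D = {x. H x \<le> 1}"
    using convex_body_pos_gauge[OF assms(1-3)] by blast
  have r0_eq: "r\<^sub>0 = (\<lambda>t\<in>{0..2*pi}. 1 / H (unit_dir t))"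
    using assms(4) radial_function_pos_gauge[OF H(1)] H(2) by simp
  then have "r\<^sub>0 \<in> radial_functions"
    using radial_functions_pos_gauge[OF H(1)] by simp
  then have r0: "continuous_on {0..2*pi} r\<^sub>0" "\<And>t. t \<in> {0..2*pi} \<Longrightarrow> 0 < r\<^sub>0 t"
    by (auto simp: radial_functions_def PiE_def Pi_def)
  obtain L where L: "0 \<le> L" "\<And>x y. \<bar>H x - H y\<bar> \<le> L * norm (x - y)"
    using pos_gauge_lipschitz[OF H(1)] by blast
  have "\<bar>H (unit_dir s) - H (unit_dir t)\<bar> \<le> L * \<bar>s - t\<bar>" for s t
    using L(2) mult_left_mono[OF unit_dir_lipschitz L(1)] by (rule order_trans)
  moreover have "0 < H (unit_dir t)" for t
    by (intro pos_gauge_pos[OF H(1)]) simp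
  ultimately obtain v where v: "\<And>t. t \<in> {0..2*pi} \<Longrightarrow> 0 < H (unit_dir t) + v \<bullet> unit_dir t"
    "\<And>w. integral {0..2*pi} (\<lambda>t. (w \<bullet> unit_dir t) / (H (unit_dir t) + v \<bullet> unit_dir t) ^ 3) = 0"
    using santalo_point[of "\<lambda>t. H (unit_dir t)" L] L(1) by blast
  define G where "G x = 1 * H x + v \<bullet> x" for x
  have G: "pos_gauge G"
    unfolding G_def using v(1) by (intro pos_gauge_affine H(1)) auto
  define J where "J = integral {0..2*pi} (\<lambda>t. 1 / (G (unit_dir t))\<^sup>2)"
  have Gp: "0 < G (unit_dir t)" for t
    by (intro pos_gauge_pos[OF G]) simp
  have "continuous_on {0..2*pi} (\<lambda>t. G (unit_dir t))"
    by (rule continuous_on_compose2[OF pos_gauge_continuous[OF G, of UNIV]])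
       (auto intro!: continuous_intros)
  then have cG: "continuous_on {0..2*pi} (\<lambda>t. 1 / (G (unit_dir t))\<^sup>2)"
    using Gp by (intro continuous_intros) (auto simp: less_imp_neq[symmetric])
  have "0 \<le> J"
    unfolding J_def by (intro integral_nonneg integrable_continuous_interval cG) simp
  moreover have "J \<noteq> 0"
    unfolding J_def using integral_eq_0_iff[OF cG] Gp by (force simp: less_imp_neq[symmetric])
  ultimately have J: "0 < J" by simp
  \<comment> \<open>Multiplying \<open>G\<close> by \<open>a\<close> divides the square integral
    \<open>J\<close> by \<open>a\<^sup>2\<close>, and the area constraint asks for the value 2. The
    vanishing moments survive the scaling.\<close>
  define a where "a = sqrt (J / 2)"
  have a: "0 < a" "a\<^sup>2 = J / 2"
    using J by (auto simp: a_def)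
  define Q where "Q x = a * H x + (a *\<^sub>R v) \<bullet> x" for x
  have Q_G: "Q x = a * G x" for x
    by (simp add: Q_def G_def algebra_simps)
  have Q: "pos_gauge Q"
    unfolding Q_def
  proof (intro pos_gauge_affine H(1) a(1))
    show "0 < a * H (unit_dir t) + (a *\<^sub>R v) \<bullet> unit_dir t" for t
      using Gp[of t] a(1) Q_G[of "unit_dir t"] by (simp add: Q_def)
  qed
  define r where "r = (\<lambda>t\<in>{0..2*pi}. 1 / Q (unit_dir t))"
  have rR: "r \<in> radial_functions"
    unfolding r_def by (rule radial_functions_pos_gauge[OF Q])
  have moment: "integral {0..2*pi} (\<lambda>t. r t ^ 3 * (w \<bullet> unit_dir t)) = 0" for w
  proof -
    have "integral {0..2*pi} (\<lambda>t. r t ^ 3 * (w \<bullet> unit_dir t))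
        = integral {0..2*pi} (\<lambda>t. 1 / a ^ 3 *
            ((w \<bullet> unit_dir t) / (H (unit_dir t) + v \<bullet> unit_dir t) ^ 3))"
      by (intro integral_cong) (simp add: r_def Q_G G_def power_divide power_mult_distrib)
    then show ?thesis
      unfolding integral_mult_right using v(2)[of w] by simp
  qed
  have "integral {0..2*pi} (\<lambda>t. (r t)\<^sup>2) = integral {0..2*pi} (\<lambda>t. 1 / a\<^sup>2 * (1 / (G (unit_dir t))\<^sup>2))"
    by (intro integral_cong) (simp add: r_def Q_G power_divide power_mult_distrib)
  also have "\<dots> = 2"
    unfolding integral_mult_right J_def[symmetric] using J by (simp add: a(2))
  finally have rC: "VP_constraints r"
    using moment[of "axis 1 1"] moment[of "axis 2 1"]
    by (simp add: VP_constraints_def inner_unit_dir axis_def)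
  have "\<forall>t\<in>{0..2*pi}. 1 / r t = a / r\<^sub>0 t + (a * v $ 1) * cos t + (a * v $ 2) * sin t"
    by (auto simp: r_def r0_eq Q_def inner_unit_dir algebra_simps)
  with a(1) have rF: "VP_form r\<^sub>0 r"
    unfolding VP_form_def by blast
  \<comment> \<open>Stated for every feasible \<open>q\<close> of the form, each with its own
    coefficient \<open>a'\<close>: any such \<open>q\<close> is the unique minimiser, hence equals
    \<open>r\<close>, which settles uniqueness within the form too.\<close>
  have minimal: "VP_solution r\<^sub>0 q \<and> (\<forall>s. VP_solution r\<^sub>0 s \<longrightarrow> s = q)"
    if q: "q \<in> radial_functions" "VP_constraints q" "VP_form r\<^sub>0 q" for q
  proof -
    obtain a' b c where f: "0 < a'"
      "\<And>t. t \<in> {0..2*pi} \<Longrightarrow> 1 / q t = a' / r\<^sub>0 t + b * cos t + c * sin t"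
      using q(3) unfolding VP_form_def by blast
    have M: "2 \<le> a' * VP_objective r\<^sub>0 s" "a' * VP_objective r\<^sub>0 s = 2 \<longleftrightarrow> s = q"
      if "s \<in> radial_functions" "VP_constraints s" for s
      using VP_form_minimal[OF r0(1) _ q(1,2) f(1) _ that] r0(2) f(2) by blast+
    have val: "a' * VP_objective r\<^sub>0 q = 2"
      using M(2)[OF q(1,2)] by simp
    have le: "VP_objective r\<^sub>0 q \<le> VP_objective r\<^sub>0 s"
      if "s \<in> radial_functions" "VP_constraints s" for s
      using M(1)[OF that] f(1) val by (metis mult_le_cancel_left_pos)
    have "s = q" if "VP_solution r\<^sub>0 s" for s
    proof -
      have s: "s \<in> radial_functions" "VP_constraints s"
        "VP_objective r\<^sub>0 s \<le> VP_objective r\<^sub>0 q"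
        using that q(1,2) by (auto simp: VP_solution_def)
      then have "VP_objective r\<^sub>0 s = VP_objective r\<^sub>0 q"
        using le by force
      then show ?thesis
        using M(2)[OF s(1,2)] val by simp
    qed
    then show ?thesis
      using q(1,2) le by (auto simp: VP_solution_def)
  qed
  \<comment> \<open>The required convex body is the unit ball of the gauge \<open>Q\<close>.\<close>
  have "convex {x. Q x \<le> 1} \<and> compact {x. Q x \<le> 1} \<and> 0 \<in> interior {x. Q x \<le> 1} \<and>
      {x. Q x \<le> 1} = starshaped_set r \<and> r = radial_function {x. Q x \<le> 1}"
    using convex_pos_gauge_sublevel[OF Q] compact_pos_gauge_sublevel[OF Q]
    by (simp add: interior_pos_gauge_sublevel[OF Q] pos_gauge_zero[OF Q] r_def
      starshaped_set_pos_gauge[OF Q] radial_function_pos_gauge[OF Q])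
  then show ?thesis
    using minimal[OF rR rC rF] minimal rF by (intro exI[of _ r]) blast
qed

end
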